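(* Let $n\geq3$. The monoid $\mathcal{DPC}_n$ is contained in $\mathcal{POR}_n\cap\mathcal{I}_n$.
   Context: For $n\geq3$, $C_n$ is the cycle graph with vertex set $\{1,\ldots,n\}$ and edges $\{i,i+1\}$ ($1\leq i\leq n-1$) and $\{1,n\}$; $\mathrm{d}(x,y)=\min\{|x-y|,n-|x-y|\}$ is the geodesic distance in $C_n$. $\mathcal{DPC}_n$ is the monoid, under composition, of all partial isometries of $C_n$, i.e. of all partial transformations $\alpha$ of $\{1,\ldots,n\}$ (including the empty one) such that $\mathrm{d}(x\alpha,y\alpha)=\mathrm{d}(x,y)$ for all $x,y\in\mathrm{Dom}(\alpha)$. $\mathcal{I}_n$ is the symmetric inverse monoid of all partial permutations (injective partial transformations) of $\{1,\ldots,n\}$. A sequence $(a_1,\ldots,a_t)$, $t\geq0$, of elements of the chain $\{1<2<\cdots<n\}$ is cyclic [anti-cyclic] if there exists no more than one index $i\in\{1,\ldots,t\}$ such that $a_i>a_{i+1}$ [$a_i<a_{i+1}$], where $a_{t+1}$ denotes $a_1$; it is oriented if it is cyclic or anti-cyclic. A partial transformation $\alpha$ of $\{1,\ldots,n\}$ with $\mathrm{Dom}(\alpha)=\{a_1<\cdots<a_t\}$ is oriented if the sequence $(a_1\alpha,\ldots,a_t\alpha)$ is oriented. $\mathcal{POR}_n$ is the monoid of all oriented partial transformations of $\{1,\ldots,n\}$. *)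

theory Defs
  imports Main
begin

section \<open>The cycle graph and its geodesic distance\<close>

definition cycle_edges :: "nat \<Rightarrow> nat set set" where
  "cycle_edges n = {{i, i + 1} | i. 1 \<le> i \<and> i \<le> n - 1} \<union> {{1, n}}"

definition cycle_adj :: "nat \<Rightarrow> (nat \<times> nat) set" where
  "cycle_adj n = {(x, y). {x, y} \<in> cycle_edges n}"

text \<open>
  The least length of a walk between two vertices. Since the cycle is connected, the
  \<open>LEAST\<close> is well defined on vertices; the closed formula is \<open>geodesic_eq\<close> below.
\<close>

definition geodesic :: "nat \<Rightarrow> nat \<Rightarrow> nat \<Rightarrow> nat" where
  "geodesic n x y = (LEAST k. (x, y) \<in> cycle_adj n ^^ k)"

section \<open>Monoids of partial transformations\<close>

text \<open>
  A partial transformation of \<open>{1..n}\<close> is a map \<open>nat \<rightharpoonup> nat\<close> with domain and range inside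
  \<open>{1..n}\<close>. Transformations act on the right, so the product of \<open>\<alpha>\<close> and \<open>\<beta>\<close> (first \<open>\<alpha>\<close>,
  then \<open>\<beta>\<close>) is \<open>\<beta> \<circ>\<^sub>m \<alpha>\<close>. All the monoids below carry this operation and are represented
  by their underlying sets.
\<close>

definition PT :: "nat \<Rightarrow> (nat \<rightharpoonup> nat) set" where
  "PT n = {\<alpha>. dom \<alpha> \<subseteq> {1..n} \<and> ran \<alpha> \<subseteq> {1..n}}"

definition DPC :: "nat \<Rightarrow> (nat \<rightharpoonup> nat) set" where
  "DPC n = {\<alpha> \<in> PT n. \<forall>x \<in> dom \<alpha>. \<forall>y \<in> dom \<alpha>.
      geodesic n (the (\<alpha> x)) (the (\<alpha> y)) = geodesic n x y}"

definition sym_inv_monoid :: "nat \<Rightarrow> (nat \<rightharpoonup> nat) set" where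
  "sym_inv_monoid n = {\<alpha> \<in> PT n. inj_on \<alpha> (dom \<alpha>)}"

text \<open>Positions are counted from 0, and the last entry is followed by the first one.\<close>

definition cyclic_seq :: "nat list \<Rightarrow> bool" where
  "cyclic_seq as \<longleftrightarrow> card {i. i < length as \<and> as ! i > as ! (Suc i mod length as)} \<le> 1"

definition anticyclic_seq :: "nat list \<Rightarrow> bool" where
  "anticyclic_seq as \<longleftrightarrow> card {i. i < length as \<and> as ! i < as ! (Suc i mod length as)} \<le> 1"

definition oriented_seq :: "nat list \<Rightarrow> bool" where
  "oriented_seq as \<longleftrightarrow> cyclic_seq as \<or> anticyclic_seq as"

definition image_seq :: "(nat \<rightharpoonup> nat) \<Rightarrow> nat list" where
  "image_seq \<alpha> = map (\<lambda>a. the (\<alpha> a)) (sorted_list_of_set (dom \<alpha>))"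

definition POR :: "nat \<Rightarrow> (nat \<rightharpoonup> nat) set" where
  "POR n = {\<alpha> \<in> PT n. oriented_seq (image_seq \<alpha>)}"

section \<open>Basic facts\<close>

lemma cycle_adj_sym: "(x, y) \<in> cycle_adj n \<Longrightarrow> (y, x) \<in> cycle_adj n"
  by (simp add: cycle_adj_def insert_commute)

lemma cycle_walk_sym: "(x, y) \<in> cycle_adj n ^^ k \<Longrightarrow> (y, x) \<in> cycle_adj n ^^ k"
proof (induction k arbitrary: y)
  case (Suc k)
  then obtain z where "(x, z) \<in> cycle_adj n ^^ k" "(z, y) \<in> cycle_adj n"
    by auto
  then show ?case
    using Suc.IH cycle_adj_sym relpow_Suc_I2 by metis
qed simp

lemma cycle_walk_up:
  assumes "1 \<le> x" "x + k \<le> n"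
  shows "(x, x + k) \<in> cycle_adj n ^^ k"
  using assms(2)
proof (induction k)
  case (Suc k)
  have "{x + k, x + Suc k} \<in> cycle_edges n"
    using assms(1) Suc.prems unfolding cycle_edges_def
    by (intro UnI1 CollectI exI[of _ "x + k"]) simp
  then show ?case
    using Suc by (auto simp: cycle_adj_def)
qed simp

lemma cycle_walk_lower:
  assumes "3 \<le> n" "x \<in> {1..n}" "(x, y) \<in> cycle_adj n ^^ k"
  shows "y \<in> {1..n} \<and>
    min \<bar>int x - int y\<bar> (int n - \<bar>int x - int y\<bar>) \<le> int k"
  using assms(3)
proof (induction k arbitrary: y)
  case 0
  then show ?case using assms(2) by simp
next
  case (Suc k)
  then obtain z where z: "(x, z) \<in> cycle_adj n ^^ k" and "{z, y} \<in> cycle_edges n"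
    by (auto simp: cycle_adj_def)
  then have "(\<exists>i. 1 \<le> i \<and> i \<le> n - 1 \<and> (z = i \<and> y = i + 1 \<or> z = i + 1 \<and> y = i))
      \<or> z = 1 \<and> y = n \<or> z = n \<and> y = 1"
    unfolding cycle_edges_def by (auto simp: doubleton_eq_iff)
  then have "z \<in> {1..n} \<and> y \<in> {1..n} \<and>
      (y = z + 1 \<or> z = y + 1 \<or> z = 1 \<and> y = n \<or> z = n \<and> y = 1)"
    using assms(1) by auto
  with Suc.IH[OF z] assms(1,2) show ?case
    unfolding min_def by (auto simp: abs_if split: if_splits)
qed

lemma geodesic_eq:
  assumes n: "3 \<le> n" and x: "x \<in> {1..n}" and y: "y \<in> {1..n}"
  shows "int (geodesic n x y) = min \<bar>int x - int y\<bar> (int n - \<bar>int x - int y\<bar>)"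
proof -
  have walk: "(x, y) \<in> cycle_adj n ^^ (y - x) \<and> (x, y) \<in> cycle_adj n ^^ (n - (y - x))"
    if "x \<le> y" "1 \<le> x" "y \<le> n" for x y
  proof
    show "(x, y) \<in> cycle_adj n ^^ (y - x)"
      using cycle_walk_up[of x "y - x" n] that by simp
    have "(x, 1) \<in> cycle_adj n ^^ (x - 1)"
      using cycle_walk_up[of 1 "x - 1" n] that cycle_walk_sym by force
    moreover have "(1, n) \<in> cycle_adj n ^^ 1"
      by (simp add: cycle_adj_def cycle_edges_def)
    moreover have "(n, y) \<in> cycle_adj n ^^ (n - y)"
      using cycle_walk_up[of y "n - y" n] that cycle_walk_sym by force
    ultimately have "(x, y) \<in> cycle_adj n ^^ (x - 1 + 1 + (n - y))"
      unfolding relpow_add by blast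
    moreover have "x - 1 + 1 + (n - y) = n - (y - x)"
      using that by simp
    ultimately show "(x, y) \<in> cycle_adj n ^^ (n - (y - x))"
      by metis
  qed
  define k where "k = nat (min \<bar>int x - int y\<bar> (int n - \<bar>int x - int y\<bar>))"
  have "(x, y) \<in> cycle_adj n ^^ k"
  proof (cases "x \<le> y")
    case True
    then have "k = y - x \<or> k = n - (y - x)"
      using x y by (auto simp: k_def min_def)
    then show ?thesis using walk[OF True] x y by auto
  next
    case False
    then have "k = x - y \<or> k = n - (x - y)"
      using x y by (auto simp: k_def min_def)
    then show ?thesis using walk[of y x] False x y cycle_walk_sym by auto
  qed
  moreover have "k \<le> j" if "(x, y) \<in> cycle_adj n ^^ j" for j
    using cycle_walk_lower[OF n x that] by (simp add: k_def nat_le_iff)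
  ultimately have "geodesic n x y = k"
    unfolding geodesic_def by (rule Least_equality)
  then show ?thesis using x y by (auto simp: k_def)
qed

lemma DPC_one: "(\<lambda>x. if x \<in> {1..n} then Some x else None) \<in> DPC n"
  by (auto simp: DPC_def PT_def dom_def ran_def)

lemma DPC_mult:
  assumes "\<alpha> \<in> DPC n" "\<beta> \<in> DPC n"
  shows "\<beta> \<circ>\<^sub>m \<alpha> \<in> DPC n"
proof -
  have "\<beta> \<circ>\<^sub>m \<alpha> \<in> PT n"
    using assms by (fastforce simp: DPC_def PT_def dom_def ran_def map_comp_Some_iff)
  moreover have "geodesic n u v = geodesic n x y"
    if uv: "(\<beta> \<circ>\<^sub>m \<alpha>) x = Some u" "(\<beta> \<circ>\<^sub>m \<alpha>) y = Some v" for x y u v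
  proof -
    obtain a b where "\<alpha> x = Some a" "\<beta> a = Some u" "\<alpha> y = Some b" "\<beta> b = Some v"
      using uv by (auto simp: map_comp_Some_iff)
    then show ?thesis
      using assms unfolding DPC_def by (metis (mono_tags, lifting) domI mem_Collect_eq option.sel)
  qed
  ultimately show ?thesis
    unfolding DPC_def by (auto simp: dom_def)
qed

end

theory Submission
  imports Defs
begin

text \<open>
  Geodesic distances in the cycle determine differences modulo \<open>n\<close> up to sign, and for a partial
  isometry the sign can be chosen uniformly, so the isometry is the restriction of a rotation or of
  a reflection. Along an increasing sequence, a restriction of a rotation wraps around at most once,
  which makes its image sequence cyclic; reflections likewise yield anti-cyclic sequences.
\<close>

text \<open>If the plus sign fails for one pair \<open>(a, b)\<close>, that pair has the minus sign,
  and so does every \<open>(a, c)\<close>: otherwise \<open>(a, c)\<close> has plus, and either sign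
  for \<open>(b, c)\<close> contradicts one of the two failures. Subtracting relations based at
  \<open>a\<close> then reaches all pairs.\<close>

lemma dvd_uniform_sign:
  fixes n :: int and f g :: "'a \<Rightarrow> int"
  assumes "\<And>x y. x \<in> D \<Longrightarrow> y \<in> D \<Longrightarrow>
    n dvd (f y - f x) - (g y - g x) \<or> n dvd (f y - f x) + (g y - g x)"
  shows "(\<forall>x\<in>D. \<forall>y\<in>D. n dvd (f y - f x) - (g y - g x)) \<or>
    (\<forall>x\<in>D. \<forall>y\<in>D. n dvd (f y - f x) + (g y - g x))"
proof (rule disjCI)
  assume "\<not> (\<forall>x\<in>D. \<forall>y\<in>D. n dvd (f y - f x) + (g y - g x))"
  then obtain a b where ab: "a \<in> D" "b \<in> D" and nab: "\<not> n dvd (f b - f a) + (g b - g a)"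
    by blast
  then have pab: "n dvd (f b - f a) - (g b - g a)"
    using assms by blast
  have pac: "n dvd (f c - f a) - (g c - g a)" if c: "c \<in> D" for c
  proof (rule ccontr)
    assume nac: "\<not> n dvd (f c - f a) - (g c - g a)"
    then have mac: "n dvd (f c - f a) + (g c - g a)"
      using assms ab c by blast
    from assms[OF ab(2) c] show False
    proof
      assume "n dvd (f c - f b) - (g c - g b)"
      from dvd_add[OF this pab] have "n dvd (f c - f a) - (g c - g a)"
        by (simp add: algebra_simps)
      with nac show False by simp
    next
      assume "n dvd (f c - f b) + (g c - g b)"
      from dvd_diff[OF mac this] have "n dvd (f b - f a) + (g b - g a)"
        by (simp add: algebra_simps)
      with nab show False by simp
    qed
  qed
  show "\<forall>x\<in>D. \<forall>y\<in>D. n dvd (f y - f x) - (g y - g x)"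
  proof (intro ballI)
    fix x y assume "x \<in> D" "y \<in> D"
    from dvd_diff[OF pac[OF this(2)] pac[OF this(1)]]
    show "n dvd (f y - f x) - (g y - g x)"
      by (simp add: algebra_simps)
  qed
qed

lemma geodesic_eq_imp_dvd:
  assumes "3 \<le> n" "x \<in> {1..n}" "y \<in> {1..n}" "u \<in> {1..n}" "v \<in> {1..n}"
    and "geodesic n u v = geodesic n x y"
  shows "int n dvd (int v - int u) - (int y - int x) \<or>
    int n dvd (int v - int u) + (int y - int x)"
proof -
  have "min \<bar>int u - int v\<bar> (int n - \<bar>int u - int v\<bar>) =
      min \<bar>int x - int y\<bar> (int n - \<bar>int x - int y\<bar>)"
    using assms geodesic_eq by metis
  \<comment> \<open>Equal minima mean that the absolute differences either agree or add up to
    \<open>n\<close>; removing the absolute values leaves a sum or a difference equal to 0 or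
    \<plusminus>n.\<close>
  then consider "(int v - int u) - (int y - int x) \<in> {0, int n, - int n}"
    | "(int v - int u) + (int y - int x) \<in> {0, int n, - int n}"
    unfolding insert_iff empty_iff by (smt (verit, best))
  then show ?thesis
    by cases auto
qed

text \<open>Here \<open>d\<close> is a gap in the domain and \<open>m\<close> the gap between the
  images. The bounds place \<open>m - d\<close> strictly between \<open>-2 * n\<close> and
  \<open>n\<close>, so the only multiples left are 0 and \<open>-n\<close>.\<close>

lemma wrapped_difference:
  fixes m n d :: int
  assumes "n dvd m - d" "- n < m" "m < n" "0 < d" "d < n"
  shows "m = d \<or> m = d - n"
proof -
  obtain k where k: "m - d = n * k"
    using assms(1) by (auto elim: dvdE)
  have "n * k < n * 1" "n * (-2) < n * k"
    using assms k by linarith+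
  then have "k < 1" "-2 < k"
    using assms by (simp_all only: mult_less_cancel_left_pos)
  then have "k = 0 \<or> k = -1"
    by linarith
  then show ?thesis
    using k by auto
qed

text \<open>Each descent inside the list costs a wrap by \<open>n\<close>, while the hypothesis
  allows at most one wrap between any two entries; the closing step back to the first entry is
  treated separately. Integer values of \<open>f\<close> let the lemma serve both a map and its
  negative.\<close>

lemma card_cyclic_descents_le_1:
  fixes f :: "nat \<Rightarrow> int"
  assumes sorted: "sorted_wrt (<) l" and range: "set l \<subseteq> {1..n}"
    and f: "\<And>x y. x \<in> set l \<Longrightarrow> y \<in> set l \<Longrightarrow> x < y \<Longrightarrow>
      f y - f x = int y - int x \<or> f y - f x = int y - int x - int n"
  shows "card {i. i < length l \<and> f (l ! (Suc i mod length l)) < f (l ! i)} \<le> 1"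
proof -
  have False if ij: "i < j" "j < length l" and di: "f (l ! (Suc i mod length l)) < f (l ! i)"
    and dj: "f (l ! (Suc j mod length l)) < f (l ! j)" for i j
  proof -
    \<comment> \<open>Since \<open>i < j\<close>, the successor of \<open>i\<close> does not wrap
      around, so \<open>v\<close> needs no \<open>mod\<close>; only \<open>z\<close> may be the
      first entry.\<close>
    define u v w z where "u = l ! i" and "v = l ! Suc i" and "w = l ! j"
      and "z = l ! (Suc j mod length l)"
    have less: "l ! p < l ! q" if "p < q" "q < length l" for p q
      using sorted that by (simp add: sorted_wrt_iff_nth_less)
    have mem: "u \<in> set l" "v \<in> set l" "w \<in> set l" "z \<in> set l"
      using ij unfolding u_def v_def w_def z_def by (auto intro!: nth_mem mod_less_divisor)
    then have bounds: "1 \<le> z" "w \<le> n"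
      using range by auto
    have "u < v"
      using less[of i "Suc i"] ij by (simp add: u_def v_def)
    have "v \<le> w"
      using less[of "Suc i" j] ij by (cases "j = Suc i") (auto simp: v_def w_def)
    have "f v < f u" "f z < f w"
      using di dj ij by (simp_all add: u_def v_def w_def z_def)
    have uv: "f v - f u = int v - int u - int n"
      using f[OF mem(1,2)] \<open>u < v\<close> \<open>f v < f u\<close> by linarith
    have vw: "f w - f v = int w - int v \<or> f w - f v = int w - int v - int n"
      using f[OF mem(2,3)] \<open>v \<le> w\<close> by (cases "v = w") auto
    \<comment> \<open>Adding \<open>uv\<close> and \<open>vw\<close> gives one or two wraps, and the
      hypothesis on the pair \<open>(u, w)\<close> excludes two.\<close>
    have uw: "f w - f u = int w - int u - int n"
      using f[OF mem(1,3)] uv vw bounds \<open>u < v\<close> \<open>v \<le> w\<close> by linarith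
    show False
    proof (cases "Suc j < length l")
      case True
      then have "w < z"
        using less by (simp add: w_def z_def)
      then show False
        \<comment> \<open>The descent from \<open>w\<close> to \<open>z\<close> adds a second wrap,
          which is impossible for the pair \<open>(u, z)\<close>.\<close>
        using f[OF mem(3,4)] f[OF mem(1,4)] uw \<open>f z < f w\<close> \<open>u < v\<close> \<open>v \<le> w\<close> bounds by linarith
    next
      case False
      then have "Suc j = length l"
        using ij by simp
      then have "z \<le> u"
        using less[of 0 i] ij by (cases "i = 0") (auto simp: u_def z_def)
      then have "f u - f z = int u - int z \<or> f u - f z = int u - int z - int n"
        using f[OF mem(4,1)] by (cases "z = u") auto
      then show False
        \<comment> \<open>Going from \<open>z\<close> through \<open>u\<close> to \<open>w\<close>
          wraps at least once, so \<open>f w - f z\<close> is at most \<open>w - z - n\<close>. This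
          is negative because \<open>w - z < n\<close>, against the descent from \<open>w\<close> to
          \<open>z\<close>.\<close>
        using uw \<open>f z < f w\<close> bounds by linarith
    qed
  qed
  then have "\<And>i j. i \<in> {i. i < length l \<and> f (l ! (Suc i mod length l)) < f (l ! i)} \<Longrightarrow>
      j \<in> {i. i < length l \<and> f (l ! (Suc i mod length l)) < f (l ! i)} \<Longrightarrow> i = j"
    by (metis (mono_tags, lifting) linorder_neqE_nat mem_Collect_eq)
  then show ?thesis
    using card_le_Suc0_iff_eq[of "{i. i < length l \<and> f (l ! (Suc i mod length l)) < f (l ! i)}"]
    by auto
qed

theorem corollary1p2:
  fixes n :: nat
  assumes "n \<ge> 3"
  shows "DPC n \<subseteq> POR n \<inter> sym_inv_monoid n"
proof
  fix \<alpha> assume \<alpha>: "\<alpha> \<in> DPC n"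
  define D where "D = dom \<alpha>"
  define f where "f x = int (the (\<alpha> x))" for x
  define l where "l = sorted_list_of_set D"
  have PT: "\<alpha> \<in> PT n"
    using \<alpha> by (simp add: DPC_def)
  then have D: "D \<subseteq> {1..n}"
    by (simp add: PT_def D_def)
  have img: "the (\<alpha> x) \<in> {1..n}" if "x \<in> D" for x
    using PT that by (auto simp: PT_def D_def ran_def)
  have "finite D"
    using D finite_subset by blast
  then have l: "set l = D" "sorted_wrt (<) l"
    by (simp_all add: l_def)
  have seq: "image_seq \<alpha> = map (\<lambda>x. the (\<alpha> x)) l"
    by (simp add: image_seq_def l_def D_def)
  \<comment> \<open>Keeps the wrapped index in range, so that the entries of
    \<open>image_seq \<alpha>\<close> can be read off through \<open>map\<close>.\<close>
  have succ: "Suc i mod length l < length l" if "i < length l" for i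
    using that by (intro mod_less_divisor) auto
  have "int n dvd (f y - f x) - (int y - int x) \<or> int n dvd (f y - f x) + (int y - int x)"
    if xy: "x \<in> D" "y \<in> D" for x y
  proof -
    have "geodesic n (the (\<alpha> x)) (the (\<alpha> y)) = geodesic n x y"
      using \<alpha> xy by (simp add: DPC_def D_def)
    then show ?thesis
      using geodesic_eq_imp_dvd[OF assms, of x y] xy D img unfolding f_def by blast
  qed
  then have sign: "(\<forall>x\<in>D. \<forall>y\<in>D. int n dvd (f y - f x) - (int y - int x)) \<or>
      (\<forall>x\<in>D. \<forall>y\<in>D. int n dvd (f y - f x) + (int y - int x))"
    by (rule dvd_uniform_sign)
  have diff_less: "f y - f x < int n" if "x \<in> D" "y \<in> D" for x y
    using img[OF that(1)] img[OF that(2)] by (simp add: f_def)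
  have gap_less: "int y - int x < int n" if "x \<in> D" "y \<in> D" for x y
  proof -
    have "1 \<le> x" "y \<le> n"
      using D that by auto
    then show ?thesis
      by linarith
  qed

  have "inj_on \<alpha> (dom \<alpha>)"
  proof (rule linorder_inj_onI)
    fix x y assume "x < y" and xy: "x \<in> dom \<alpha>" "y \<in> dom \<alpha>"
    \<comment> \<open>Equal images would make \<open>n\<close> divide the gap \<open>y - x\<close>
      under either sign, but that gap lies strictly between 0 and \<open>n\<close>.\<close>
    then have "\<not> int n dvd int y - int x"
      using gap_less[of x y] zdvd_not_zless[of "int y - int x" "int n"] by (simp add: D_def)
    moreover have "int n dvd (f y - f x) - (int y - int x) \<or> int n dvd (f y - f x) + (int y - int x)"
      using sign xy unfolding D_def by blast
    ultimately have "f y - f x \<noteq> 0"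
      by (metis add_0 diff_0 dvd_minus_iff)
    then show "\<alpha> x \<noteq> \<alpha> y"
      by (auto simp: f_def)
  qed auto
  moreover have "oriented_seq (image_seq \<alpha>)"
    using sign
  proof
    assume rot: "\<forall>x\<in>D. \<forall>y\<in>D. int n dvd (f y - f x) - (int y - int x)"
    have "card {i. i < length l \<and> f (l ! (Suc i mod length l)) < f (l ! i)} \<le> 1"
    proof (rule card_cyclic_descents_le_1[OF l(2)])
      fix x y assume "x \<in> set l" "y \<in> set l" "x < y"
      then show "f y - f x = int y - int x \<or> f y - f x = int y - int x - int n"
        using rot diff_less[of x y] diff_less[of y x] gap_less[of x y] l(1)
        by (intro wrapped_difference) auto
    qed (use D l(1) in simp)
    moreover have "{i. i < length l \<and> f (l ! (Suc i mod length l)) < f (l ! i)} =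
        {i. i < length (image_seq \<alpha>) \<and>
          image_seq \<alpha> ! i > image_seq \<alpha> ! (Suc i mod length (image_seq \<alpha>))}"
      by (auto simp: seq f_def succ)
    ultimately show ?thesis
      by (simp add: oriented_seq_def cyclic_seq_def)
  next
    assume refl: "\<forall>x\<in>D. \<forall>y\<in>D. int n dvd (f y - f x) + (int y - int x)"
    \<comment> \<open>Negating the values turns the reflection into a rotation, and descents of
      \<open>- f\<close> are exactly ascents of \<open>f\<close>.\<close>
    have "card {i. i < length l \<and> - f (l ! (Suc i mod length l)) < - f (l ! i)} \<le> 1"
    proof (rule card_cyclic_descents_le_1[OF l(2)])
      fix x y assume xy: "x \<in> set l" "y \<in> set l" "x < y"
      then have "int n dvd - ((f y - f x) + (int y - int x))"
        using refl l(1) by (simp only: dvd_minus_iff)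
      then have "int n dvd (- f y - - f x) - (int y - int x)"
        by (simp add: algebra_simps)
      then show "- f y - - f x = int y - int x \<or> - f y - - f x = int y - int x - int n"
        using xy diff_less[of x y] diff_less[of y x] gap_less[of x y] l(1)
        by (intro wrapped_difference) auto
    qed (use D l(1) in simp)
    moreover have "{i. i < length l \<and> - f (l ! (Suc i mod length l)) < - f (l ! i)} =
        {i. i < length (image_seq \<alpha>) \<and>
          image_seq \<alpha> ! i < image_seq \<alpha> ! (Suc i mod length (image_seq \<alpha>))}"
      by (auto simp: seq f_def succ)
    ultimately show ?thesis
      by (simp add: oriented_seq_def anticyclic_seq_def)
  qed
  ultimately show "\<alpha> \<in> POR n \<inter> sym_inv_monoid n"
    using PT by (simp add: POR_def sym_inv_monoid_def)
qed

end
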